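(* Let $G=(X\cup Y,E)$ be a complete bipartite graph and $\mathcal{I}$ a partition of $X$. Let $m\ge 3$, let $I_1,I_2\in\mathcal{I}$ be distinct, $i_1\in I_1$, let $i_2,\ldots,i_m\in I_2$ be pairwise distinct and $j_1,\ldots,j_m\in Y$ pairwise distinct. Then the inequality $$x_{i_1}+\sum_{p=2}^m y_{j_p}-\sum_{p=1}^m z_{i_1j_p}+\sum_{p=2}^m\left(z_{i_pj_1}-z_{i_pj_p}\right)\ge 0,$$ as well as each of its structure-preserving copyings, defines a facet of $P(G,\mathcal{I})$.
   Context: $G=(X\cup Y,E)$ is a finite complete bipartite graph with disjoint node sets $X,Y$, i.e. $E=\{\{i,j\}: i\in X, j\in Y\}$. $\mathcal{I}$ is a partition of $X$ into non-empty subsets. Vectors in $\mathbb{R}^{X\cup Y\cup E}$ are written $(x,y,z)$. Put $X^{\mathcal{I}}=\{x\in\{0,1\}^X : \sum_{i\in I}x_i\le 1\ \forall I\in\mathcal{I}\}$ and $$P(G,\mathcal{I})=\operatorname{conv}\{(x,y,z)\in\{0,1\}^{X\cup Y\cup E} : x_iy_j=z_{ij}\ \forall\{i,j\}\in E,\ x\in X^{\mathcal{I}}\}.$$ Copying: for an inequality with coefficient vector $a\in\mathbb{R}^{X\cup Y\cup E}$ and $i\in X$, let $r_i=(a_i,(a_{ij})_{j\in Y})$ be the tuple of coefficients of node $i$ and its incident edges; for $I\in\mathcal{I}$ let $H^I=\{r_i: i\in I\}$. A copying of the inequality is an inequality with the same sense, the same right-hand side and the same coefficients of the $y$-variables in which,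 for each $I\in\mathcal{I}$ and each $i\in I$, the tuple $r_i$ is replaced by some tuple in $H^I$. It is structure-preserving if, for each $I\in\mathcal{I}$, every tuple in $H^I\setminus\{(0,\ldots,0)\}$ is chosen for at least one $i\in I$. *)

theory Defs
  imports "HOL-Analysis.Analysis" "HOL-Library.Disjoint_Sets"
begin

text \<open>
  The complete bipartite graph \<open>G\<close> has the finite types \<open>'x\<close> and \<open>'y\<close> as its node sets
  \<open>X\<close> and \<open>Y\<close>, and the edge \<open>{i, j}\<close> with \<open>i \<in> X\<close>, \<open>j \<in> Y\<close> is encoded as the pair \<open>(i, j)\<close>;
  since \<open>G\<close> is complete, its edge set is all of \<open>'x \<times> 'y\<close>.
  The type below is \<open>\<real>\<^bsup>X \<union> Y \<union> E\<^esup>\<close>, written as triples \<open>(x, y, z)\<close>.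
\<close>

type_synonym ('x, 'y) xyz = "(real ^ 'x) \<times> (real ^ 'y) \<times> (real ^ ('x \<times> 'y))"

definition X_part :: "'x::finite set set \<Rightarrow> (real ^ 'x) set" where
  "X_part \<I> = {x. (\<forall>i. x $ i \<in> {0, 1}) \<and> (\<forall>I\<in>\<I>. (\<Sum>i\<in>I. x $ i) \<le> 1)}"

definition P_poly :: "'x::finite set set \<Rightarrow> ('x, 'y::finite) xyz set" where
  "P_poly \<I> = convex hull {(x, y, z).
      (\<forall>i. x $ i \<in> {0, 1}) \<and> (\<forall>j. y $ j \<in> {0, 1}) \<and> (\<forall>e. z $ e \<in> {0, 1}) \<and>
      (\<forall>i j. x $ i * y $ j = z $ (i, j)) \<and> x \<in> X_part \<I>}"

text \<open>The pair \<open>(a, \<beta>)\<close> stands for the inequality \<open>a \<bullet> v \<ge> \<beta>\<close>.\<close>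

type_synonym ('x, 'y) inequality = "('x, 'y) xyz \<times> real"

fun defines_facet ::
  "('x::finite, 'y::finite) inequality \<Rightarrow> ('x, 'y) xyz set \<Rightarrow> bool" where
  "defines_facet (a, \<beta>) P \<longleftrightarrow>
     (\<forall>v\<in>P. a \<bullet> v \<ge> \<beta>) \<and> {v \<in> P. a \<bullet> v = \<beta>} facet_of P"

fun node_tuple :: "('x::finite, 'y::finite) xyz \<Rightarrow> 'x \<Rightarrow> real \<times> (real ^ 'y)" where
  "node_tuple (ax, ay, az) i = (ax $ i, (\<chi> j. az $ (i, j)))"

definition tuple_set ::
  "('x::finite, 'y::finite) xyz \<Rightarrow> 'x set \<Rightarrow> (real \<times> (real ^ 'y)) set" where
  "tuple_set a I = node_tuple a ` I"

fun y_coeffs :: "('x::finite, 'y::finite) xyz \<Rightarrow> real ^ 'y" where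
  "y_coeffs (ax, ay, az) = ay"

text \<open>\<open>is_copying \<I> (a, \<beta>) (b, \<gamma>)\<close>: the second inequality is a copying of the first.\<close>

fun is_copying ::
  "'x::finite set set \<Rightarrow> ('x, 'y::finite) inequality \<Rightarrow> ('x, 'y) inequality \<Rightarrow> bool" where
  "is_copying \<I> (a, \<beta>) (b, \<gamma>) \<longleftrightarrow>
     \<gamma> = \<beta> \<and> y_coeffs b = y_coeffs a \<and>
     (\<forall>I\<in>\<I>. \<forall>i\<in>I. node_tuple b i \<in> tuple_set a I)"

fun is_structure_preserving_copying ::
  "'x::finite set set \<Rightarrow> ('x, 'y::finite) inequality \<Rightarrow> ('x, 'y) inequality \<Rightarrow> bool" where
  "is_structure_preserving_copying \<I> (a, \<beta>) (b, \<gamma>) \<longleftrightarrow>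
     is_copying \<I> (a, \<beta>) (b, \<gamma>) \<and>
     (\<forall>I\<in>\<I>. \<forall>r\<in>tuple_set a I - {(0, 0)}. \<exists>i\<in>I. node_tuple b i = r)"

definition facet_coeffs ::
  "nat \<Rightarrow> (nat \<Rightarrow> 'x::finite) \<Rightarrow> (nat \<Rightarrow> 'y::finite) \<Rightarrow> ('x, 'y) xyz" where
  "facet_coeffs m i j =
     (axis (i 1) 1,
      (\<Sum>p=2..m. axis (j p) 1),
      - (\<Sum>p=1..m. axis (i 1, j p) 1) + (\<Sum>p=2..m. axis (i p, j 1) 1 - axis (i p, j p) 1))"

lemma inner_facet_coeffs:
  "facet_coeffs m i j \<bullet> (x, y, z) =
     x $ i 1 + (\<Sum>p=2..m. y $ j p) - (\<Sum>p=1..m. z $ (i 1, j p))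
       + (\<Sum>p=2..m. z $ (i p, j 1) - z $ (i p, j p))"
  by (simp add: facet_coeffs_def inner_axis' inner_sum_left inner_add_left inner_diff_left)

end

theory Submission
  imports Defs
begin

text \<open>
  On a 0/1 point the copied inequality only sees which tuple is selected in \<open>I1\<close> (the one of
  \<open>i\<^sub>1\<close> or zero) and which is selected in \<open>I2\<close> (the one of some \<open>i\<^sub>p\<close> or zero), so validity is a
  four-fold case distinction, and the tight 0/1 points are known explicitly.  Since the origin is
  tight, the face is a facet once every linear form vanishing on the tight 0/1 points is a multiple
  of the given one.  Comparing tight points with at most two selected nodes of \<open>X\<close> and at most
  three of \<open>Y\<close> determines all coefficients of such a form up to a common factor.
\<close>

section \<open>Facets through the origin\<close>

text \<open>The forms vanishing on the face make up the orthogonal complement of its span. By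
  \<open>unique\<close> this complement is at most a line, so the span has codimension at most 1,
  and since the face contains 0 the same bound holds for its affine dimension. The point
  \<open>w\<close> makes the face proper, which forces \<open>P\<close> to be full-dimensional and
  the face to lie exactly one dimension below it.\<close>

lemma facet_of_homogeneous_hyperplane:
  fixes P :: "'a::euclidean_space set"
  assumes "convex P" "0 \<in> P"
    and valid: "\<And>v. v \<in> P \<Longrightarrow> a \<bullet> v \<ge> 0"
    and "w \<in> P" "a \<bullet> w \<noteq> 0"
    and unique: "\<And>g. (\<And>v. v \<in> P \<Longrightarrow> a \<bullet> v = 0 \<Longrightarrow> g \<bullet> v = 0) \<Longrightarrow> \<exists>c. g = c *\<^sub>R a"
  shows "{v \<in> P. a \<bullet> v = 0} facet_of P"
proof -
  let ?F = "{v \<in> P. a \<bullet> v = 0}"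
  have face: "?F face_of P"
    using face_of_Int_supporting_hyperplane_ge[OF assms(1) valid] by (simp add: Int_def)
  have "0 \<in> ?F" using assms(2) by simp
  have "?F \<noteq> P" using assms(4,5) by blast
  then have "aff_dim ?F < aff_dim P"
    using face_of_aff_dim_lt[OF assms(1) face] by blast
  moreover have "aff_dim P \<le> int DIM('a)" by (rule aff_dim_le_DIM)
  moreover have "aff_dim ?F \<ge> int DIM('a) - 1"
  proof -
    let ?O = "{y \<in> UNIV. \<forall>x\<in>span ?F. orthogonal x y}"
    have "dim ?O + dim (span ?F) = dim (UNIV :: 'a set)"
      by (rule dim_subspace_orthogonal_to_vectors) auto
    moreover have "?O \<subseteq> span {a}"
    proof
      fix g assume "g \<in> ?O"
      then have "\<exists>c. g = c *\<^sub>R a"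
        by (intro unique) (auto simp: orthogonal_def inner_commute intro: span_base)
      then show "g \<in> span {a}" by (auto simp: span_singleton)
    qed
    then have "dim ?O \<le> 1"
      using dim_le_card[of ?O "{a}"] by simp
    ultimately have "dim ?F + 1 \<ge> DIM('a)" by (simp add: dim_UNIV)
    then show ?thesis using aff_dim_zero[of ?F] hull_inc[OF \<open>0 \<in> ?F\<close>, of affine] by simp
  qed
  ultimately show ?thesis
    using face \<open>0 \<in> ?F\<close> unfolding facet_of_def by auto
qed

section \<open>The 0/1 points of the polytope as pairs of node sets\<close>

definition partial_transversal :: "'a set set \<Rightarrow> 'a set \<Rightarrow> bool" where
  "partial_transversal \<I> S \<longleftrightarrow> (\<forall>I\<in>\<I>. card (S \<inter> I) \<le> 1)"

text \<open>A 0/1 point is encoded by the supports \<open>S\<close> of x and \<open>T\<close> of y.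
  Its z-part is forced by the product constraints.\<close>

definition vertex :: "'x::finite set \<Rightarrow> 'y::finite set \<Rightarrow> ('x, 'y) xyz" where
  "vertex S T = (\<chi> i. of_bool (i \<in> S), \<chi> j. of_bool (j \<in> T),
     \<chi> e. of_bool (fst e \<in> S \<and> snd e \<in> T))"

lemma partial_transversal_empty: "partial_transversal \<I> {}"
  by (simp add: partial_transversal_def)

lemma partial_transversal_singleton: "partial_transversal \<I> {i}"
  by (auto simp: partial_transversal_def Int_insert_left)

lemma partial_transversal_pair:
  assumes "partition_on A \<I>" "I1 \<in> \<I>" "i \<in> I1" "k \<notin> I1"
  shows "partial_transversal \<I> {i, k}"
proof -
  have "\<not> (i \<in> I \<and> k \<in> I)" if "I \<in> \<I>" for I
    using assms that by (metis disjnt_iff partition_onD2 pairwiseD)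
  then show ?thesis
    by (auto simp: partial_transversal_def Int_insert_left)
qed

lemma partial_transversal_cases:
  fixes S :: "'a::finite set"
  assumes "partial_transversal \<I> S" "I \<in> \<I>"
  obtains "S \<inter> I = {}" | i where "S \<inter> I = {i}" "i \<in> I"
proof -
  have "card (S \<inter> I) \<le> Suc 0" using assms by (auto simp: partial_transversal_def)
  then have "S \<inter> I = {} \<or> (\<exists>i. S \<inter> I = {i})"
    by (metis card_le_Suc0_iff_eq finite is_singletonI' is_singleton_def)
  then show ?thesis using that by blast
qed

lemma X_part_indicator:
  "(\<chi> i. of_bool (i \<in> S)) \<in> X_part \<I> \<longleftrightarrow> partial_transversal \<I> S"
  by (auto simp: X_part_def partial_transversal_def Int_commute sum_of_bool_eq)

lemma P_poly_eq_vertices: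
  "P_poly \<I> = convex hull {vertex S T | S T. partial_transversal \<I> S}"
proof -
  let ?V = "{(x, y, z :: real ^ ('a \<times> 'b)).
      (\<forall>i. x $ i \<in> {0, 1}) \<and> (\<forall>j. y $ j \<in> {0, 1}) \<and> (\<forall>e. z $ e \<in> {0, 1}) \<and>
      (\<forall>i j. x $ i * y $ j = z $ (i, j)) \<and> x \<in> X_part \<I>}"
  have is_vertex: "(x, y, z) \<in> {vertex S T | S T. partial_transversal \<I> S}"
    if "\<forall>i. x $ i \<in> {0, 1}" "\<forall>j. y $ j \<in> {0, 1}" "\<forall>i j. x $ i * y $ j = z $ (i, j)"
      "x \<in> X_part \<I>" for x y and z :: "real ^ ('a \<times> 'b)"
  proof -
    \<comment> \<open>The supports of x and y recover the point, because every coordinate is 0 or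
      1.\<close>
    let ?S = "{i. x $ i = 1}" and ?T = "{j. y $ j = 1}"
    have x: "x = (\<chi> i. of_bool (i \<in> ?S))" and y: "y = (\<chi> j. of_bool (j \<in> ?T))"
      using that(1,2) by (auto simp: vec_eq_iff)
    have "z $ e = of_bool (fst e \<in> ?S \<and> snd e \<in> ?T)" for e
      using that(1)[rule_format, of "fst e"] that(2)[rule_format, of "snd e"]
        that(3)[rule_format, of "fst e" "snd e"]
      by auto
    then have "z = (\<chi> e. of_bool (fst e \<in> ?S \<and> snd e \<in> ?T))"
      by (simp add: vec_eq_iff)
    then have "(x, y, z) = vertex ?S ?T" using x y by (simp add: vertex_def)
    moreover have "partial_transversal \<I> ?S"
      using that(4) x X_part_indicator[of ?S \<I>] by simp
    ultimately show ?thesis by blast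
  qed
  have vertex_in: "vertex S T \<in> ?V" if "partial_transversal \<I> S" for S T
    using that X_part_indicator[of S \<I>] by (auto simp: vertex_def)
  have "?V = {vertex S T | S T. partial_transversal \<I> S}"
  proof
    show "?V \<subseteq> {vertex S T | S T. partial_transversal \<I> S}"
      using is_vertex by auto
    show "{vertex S T | S T. partial_transversal \<I> S} \<subseteq> ?V"
    proof
      fix v :: "('a, 'b) xyz" assume "v \<in> {vertex S T | S T. partial_transversal \<I> S}"
      then obtain S T where v: "v = vertex S T" "partial_transversal \<I> S" by blast
      show "v \<in> ?V" unfolding v(1) by (rule vertex_in[OF v(2)])
    qed
  qed
  then show ?thesis by (simp add: P_poly_def)
qed

lemma inner_vertex:
  "(ax, ay, az) \<bullet> vertex S T =
     (\<Sum>i\<in>S. ax $ i) + (\<Sum>j\<in>T. ay $ j) + (\<Sum>i\<in>S. \<Sum>j\<in>T. az $ (i, j))"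
proof -
  have "(\<Sum>e\<in>UNIV. az $ e * of_bool (fst e \<in> S \<and> snd e \<in> T)) = (\<Sum>e\<in>S \<times> T. az $ e)"
    by (rule sum.mono_neutral_cong_right) auto
  moreover have "(\<Sum>i\<in>UNIV. ax $ i * of_bool (i \<in> S)) = (\<Sum>i\<in>S. ax $ i)"
    by (rule sum.mono_neutral_cong_right) auto
  moreover have "(\<Sum>j\<in>UNIV. ay $ j * of_bool (j \<in> T)) = (\<Sum>j\<in>T. ay $ j)"
    by (rule sum.mono_neutral_cong_right) auto
  ultimately show ?thesis
    by (simp add: vertex_def inner_vec_def sum.cartesian_product)
qed

section \<open>Facet proof for an arbitrary copied inequality\<close>

text \<open>The tuple of \<open>i 1\<close>, where \<open>j1\<close> stands for \<open>j 1\<close>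
  and \<open>J\<close> for the set of the remaining \<open>j p\<close>.\<close>

definition hub_tuple :: "'y \<Rightarrow> 'y::finite set \<Rightarrow> real \<times> (real ^ 'y)" where
  "hub_tuple j1 J = (1, \<chi> j. - of_bool (j = j1) - of_bool (j \<in> J))"

text \<open>The tuple of \<open>i p\<close> for p at least 2, where \<open>q\<close> stands for
  \<open>j p\<close>.\<close>

definition spoke_tuple :: "'y \<Rightarrow> 'y::finite \<Rightarrow> real \<times> (real ^ 'y)" where
  "spoke_tuple j1 q = (0, \<chi> j. of_bool (j = j1) - of_bool (j = q))"

text \<open>The indices p disappear here: only the tuple carried by each node matters, so the
  original inequality and its structure-preserving copyings are treated alike. The
  \<open>tuple_\<close> assumptions express copying; \<open>hub_exists\<close> and
  \<open>spoke_exists\<close> express preservation of the structure.\<close>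

locale copied_inequality =
  fixes \<I> :: "'x::finite set set"
    and I1 I2 :: "'x set"
    and ax :: "real ^ 'x" and ay :: "real ^ 'y::finite" and az :: "real ^ ('x \<times> 'y)"
    and j1 :: 'y and J :: "'y set"
  assumes partition: "partition_on UNIV \<I>"
    and I1: "I1 \<in> \<I>" and I2: "I2 \<in> \<I>" and neq: "I1 \<noteq> I2"
    and ay: "ay = (\<chi> j. of_bool (j \<in> J))"
    and j1: "j1 \<notin> J" and J: "J \<noteq> {}"
    and tuple_I1: "i \<in> I1 \<Longrightarrow> node_tuple (ax, ay, az) i \<in> {hub_tuple j1 J, 0}"
    and tuple_I2: "i \<in> I2 \<Longrightarrow> node_tuple (ax, ay, az) i \<in> insert 0 (spoke_tuple j1 ` J)"
    and tuple_other: "i \<notin> I1 \<Longrightarrow> i \<notin> I2 \<Longrightarrow> node_tuple (ax, ay, az) i = 0"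
    and hub_exists: "\<exists>i\<in>I1. node_tuple (ax, ay, az) i = hub_tuple j1 J"
    and spoke_exists: "q \<in> J \<Longrightarrow> \<exists>i\<in>I2. node_tuple (ax, ay, az) i = spoke_tuple j1 q"
begin

definition hub :: "'x \<Rightarrow> bool" where
  "hub i \<longleftrightarrow> i \<in> I1 \<and> node_tuple (ax, ay, az) i = hub_tuple j1 J"

definition spoke :: "'y \<Rightarrow> 'x \<Rightarrow> bool" where
  "spoke q i \<longleftrightarrow> q \<in> J \<and> i \<in> I2 \<and> node_tuple (ax, ay, az) i = spoke_tuple j1 q"

text \<open>Idle nodes may lie in any class, including \<open>I1\<close> and
  \<open>I2\<close>.\<close>

definition idle :: "'x \<Rightarrow> bool" where
  "idle i \<longleftrightarrow> node_tuple (ax, ay, az) i = 0"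

text \<open>The amount that selecting node \<open>i\<close> adds to the left-hand side when
  \<open>T\<close> is the support of y.\<close>

definition load :: "'y set \<Rightarrow> 'x \<Rightarrow> real" where
  "load T i = ax $ i + (\<Sum>j\<in>T. az $ (i, j))"

lemma disjoint: "I1 \<inter> I2 = {}"
  using partition I1 I2 neq by (metis partition_onD2 disjointD)

lemma node_cases:
  obtains "hub i" | q where "spoke q i" | "idle i"
  using tuple_I1[of i] tuple_I2[of i] tuple_other[of i]
  unfolding hub_def spoke_def idle_def by blast

lemma hub_coeffs:
  assumes "hub i"
  shows "ax $ i = 1" "az $ (i, j) = - of_bool (j = j1) - of_bool (j \<in> J)"
  using assms by (auto simp: hub_def hub_tuple_def vec_eq_iff)

lemma spoke_coeffs:
  assumes "spoke q i"
  shows "ax $ i = 0" "az $ (i, j) = of_bool (j = j1) - of_bool (j = q)"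
  using assms by (auto simp: spoke_def spoke_tuple_def vec_eq_iff)

lemma idle_coeffs:
  assumes "idle i"
  shows "ax $ i = 0" "az $ (i, j) = 0"
  using assms by (auto simp: idle_def vec_eq_iff zero_prod_def)

lemma load_hub: "hub i \<Longrightarrow> load T i = 1 - of_bool (j1 \<in> T) - real (card (T \<inter> J))"
  by (simp add: load_def hub_coeffs sum_subtractf sum_negf)

lemma load_spoke: "spoke q i \<Longrightarrow> load T i = of_bool (j1 \<in> T) - of_bool (q \<in> T)"
  by (simp add: load_def spoke_coeffs sum_subtractf of_bool_def)

lemma load_idle: "idle i \<Longrightarrow> load T i = 0"
  by (simp add: load_def idle_coeffs)

lemma inner_vertex_load:
  "(ax, ay, az) \<bullet> vertex S T = real (card (T \<inter> J)) + (\<Sum>i\<in>S. load T i)"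
  by (simp add: inner_vertex ay load_def sum.distrib sum_of_bool_eq)

text \<open>With t = |T \<inter> J| and brackets for 0/1 truth values, the left-hand side is t if
  neither a hub nor a spoke is selected, 1 - [j1 \<in> T] for a hub alone, t - [q \<in> T] +
  [j1 \<in> T] for a spoke of \<open>q\<close> alone, and 1 - [q \<in> T] for both. None of these is
  negative.\<close>

lemma vertex_valid:
  assumes "partial_transversal \<I> S"
  shows "(ax, ay, az) \<bullet> vertex S T \<ge> 0"
proof -
  have "(\<Sum>i\<in>S. load T i) = (\<Sum>i\<in>(S \<inter> I1) \<union> (S \<inter> I2). load T i)"
  proof (rule sum.mono_neutral_right)
    show "\<forall>i\<in>S - (S \<inter> I1 \<union> S \<inter> I2). load T i = 0"
      using tuple_other load_idle unfolding idle_def by blast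
  qed auto
  also have "\<dots> = (\<Sum>i\<in>S \<inter> I1. load T i) + (\<Sum>i\<in>S \<inter> I2. load T i)"
    using disjoint by (intro sum.union_disjoint) auto
  finally have split: "(ax, ay, az) \<bullet> vertex S T =
      real (card (T \<inter> J)) + (\<Sum>i\<in>S \<inter> I1. load T i) + (\<Sum>i\<in>S \<inter> I2. load T i)"
    by (simp add: inner_vertex_load)
  have sum1: "(\<Sum>i\<in>S \<inter> I1. load T i) \<in> {0, 1 - of_bool (j1 \<in> T) - real (card (T \<inter> J))}"
    using assms I1
  proof (cases rule: partial_transversal_cases)
    case (2 i)
    then have "hub i \<or> idle i" using tuple_I1 by (auto simp: hub_def idle_def)
    then show ?thesis using 2 by (auto simp: load_hub load_idle)
  qed auto
  have sum2: "(\<Sum>i\<in>S \<inter> I2. load T i) = 0 \<or>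
      (\<exists>q\<in>J. (\<Sum>i\<in>S \<inter> I2. load T i) = of_bool (j1 \<in> T) - of_bool (q \<in> T))"
    using assms I2
  proof (cases rule: partial_transversal_cases)
    case (2 i)
    then have "(\<exists>q\<in>J. spoke q i) \<or> idle i" using tuple_I2 by (auto simp: spoke_def idle_def)
    then show ?thesis using 2 by (auto simp: load_spoke load_idle)
  qed auto
  \<comment> \<open>This bound settles the case of a spoke without a hub.\<close>
  have "real (card (T \<inter> J)) \<ge> of_bool (q \<in> T)" if "q \<in> J" for q
  proof (cases "q \<in> T")
    case True
    then have "card (T \<inter> J) > 0" using that by (auto simp: card_gt_0_iff)
    then show ?thesis by simp
  qed auto
  then show ?thesis using sum1 sum2 unfolding split by (fastforce split: if_splits simp: of_bool_def)
qed

text \<open>Each tight vertex gives a linear equation for the coefficients of g. The equations fix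
  the coefficients on idle nodes, spokes and hubs in terms of those of y, and the points selecting
  both a hub and a spoke link all of these to one factor.\<close>

lemma form_unique:
  assumes "\<And>S T. partial_transversal \<I> S \<Longrightarrow> (ax, ay, az) \<bullet> vertex S T = 0
    \<Longrightarrow> (gx, gy, gz) \<bullet> vertex S T = 0"
  shows "\<exists>c. (gx, gy, gz) = c *\<^sub>R (ax, ay, az)"
proof -
  define load' where "load' T i = gx $ i + (\<Sum>j\<in>T. gz $ (i, j))" for T i
  have tight0: "(\<Sum>j\<in>T. gy $ j) = 0" if "T \<inter> J = {}" for T
    using assms[OF partial_transversal_empty, of T, unfolded inner_vertex_load, unfolded inner_vertex] that
    by simp
  have tight1: "(\<Sum>j\<in>T. gy $ j) + load' T i = 0"
    if "real (card (T \<inter> J)) + load T i = 0" for i T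
    using assms[OF partial_transversal_singleton, of i T, unfolded inner_vertex_load,
        unfolded inner_vertex] that
    by (simp add: load'_def)
  have tight2: "(\<Sum>j\<in>T. gy $ j) + load' T i + load' T k = 0"
    if "i \<in> I1" "k \<notin> I1" "real (card (T \<inter> J)) + load T i + load T k = 0" for i k T
  proof -
    have "i \<noteq> k" using that(1,2) by blast
    then show ?thesis
      using assms[OF partial_transversal_pair[OF partition I1 that(1,2)], of T,
          unfolded inner_vertex_load, unfolded inner_vertex] that(3)
      by (simp add: load'_def)
  qed
  obtain h where h: "hub h" using hub_exists by (auto simp: hub_def)
  \<comment> \<open>A hub together with \<open>j1\<close> is tight whatever else \<open>T\<close>
    contains.\<close>
  have hub_tight: "(\<Sum>j\<in>T. gy $ j) + load' T k = 0" if "hub k" "j1 \<in> T" for k T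
    using that by (intro tight1) (simp add: load_hub)
  \<comment> \<open>Adding a node of load 0 to such a hub point keeps it tight. Subtracting the two
    equations isolates the contribution of that node to g.\<close>
  have beside_hub: "load' T i = 0" if "i \<notin> I1" "j1 \<in> T" "load T i = 0" for i T
  proof -
    have "h \<in> I1" using h by (simp add: hub_def)
    moreover have "real (card (T \<inter> J)) + load T h + load T i = 0"
      using h that by (simp add: load_hub)
    ultimately show ?thesis using tight2[of h i T] hub_tight[OF h that(2)] that(1) by simp
  qed
  have gy0: "gy $ j = 0" if "j \<notin> J" for j
    using tight0[of "{j}"] that by simp
  have gx0: "gx $ i = 0" if "ax $ i = 0" for i
    using tight1[of "{}" i] that by (simp add: load_def load'_def)
  have gz0: "gz $ (i, j) = 0" if "ax $ i = 0" "j \<notin> J" "load {j} i = 0" for i j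
    using tight1[of "{j}" i] gx0[OF that(1)] gy0[OF that(2)] that by (simp add: load'_def)
  have hub_single: "gx $ k + gz $ (k, j1) = 0" if "hub k" for k
    using hub_tight[OF that, of "{j1}"] gy0[OF j1] by (simp add: load'_def)
  have hub_other: "gz $ (k, j) = - gy $ j" if "hub k" "j \<noteq> j1" for k j
    using hub_tight[OF that(1), of "{j1, j}"] gy0[OF j1] hub_single[OF that(1)] that(2)
    by (simp add: load'_def)
  have idle_gx: "gx $ i = 0" if "idle i" for i
    using gx0 that by (simp add: idle_coeffs)
  have idle_gz: "gz $ (i, j) = 0" if "idle i" for i j
  proof (cases "j \<in> J")
    case False
    then show ?thesis using gz0[of i j] that by (simp add: load_idle idle_coeffs)
  next
    case True
    then have "j \<noteq> j1" using j1 by blast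
    show ?thesis
    proof (cases "i \<in> I1")
      case True
      \<comment> \<open>An idle node of \<open>I1\<close> cannot be selected beside a hub. A spoke
        of \<open>j\<close> takes over that role, since it is tight with
        \<open>T = {j}\<close>.\<close>
      obtain s where s: "spoke j s" using spoke_exists \<open>j \<in> J\<close> by (auto simp: spoke_def)
      have tight: "real (card ({j} \<inter> J)) + load {j} s = 0"
        using \<open>j \<in> J\<close> \<open>j \<noteq> j1\<close> by (simp add: load_spoke[OF s])
      have "s \<notin> I1" using s disjoint by (auto simp: spoke_def)
      then have "load' {j} i = 0"
        using tight2[OF True, of s "{j}"] tight1[OF tight] tight load_idle[OF that] by simp
      then show ?thesis using idle_gx[OF that] by (simp add: load'_def)
    next
      case False
      have "gz $ (i, j1) = 0" using gz0[of i j1] that j1 by (simp add: load_idle idle_coeffs)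
      moreover have "load' {j1, j} i = 0"
        using beside_hub[OF False] load_idle[OF that] by blast
      ultimately show ?thesis using idle_gx[OF that] \<open>j \<noteq> j1\<close> by (simp add: load'_def)
    qed
  qed
  have spokeD: "q \<in> J" "i \<notin> I1" "q \<noteq> j1" "gx $ i = 0" if "spoke q i" for q i
    using that disjoint j1 gx0[of i] spoke_coeffs(1)[OF that] by (auto simp: spoke_def)
  have spoke_gzq: "gz $ (i, q) = - gy $ q" if "spoke q i" for q i
    using tight1[of "{q}" i] spokeD[OF that] by (simp add: load_spoke[OF that] load'_def)
  have spoke_gz1: "gz $ (i, j1) = gy $ q" if "spoke q i" for q i
  proof -
    \<comment> \<open>The +1 at \<open>j1\<close> and the -1 at \<open>q\<close> cancel, so the
      spoke has load 0 and fits beside a hub.\<close>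
    have "load' {j1, q} i = 0"
      by (rule beside_hub) (use spokeD[OF that] load_spoke[OF that] in auto)
    then show ?thesis using spokeD[OF that] spoke_gzq[OF that] by (simp add: load'_def)
  qed
  have spoke_gz: "gz $ (i, j) = 0" if "spoke q i" "j \<noteq> j1" "j \<noteq> q" for q i j
  proof -
    \<comment> \<open>The spoke has coefficient 0 at the further node \<open>j\<close>, so its load
      stays 0; comparison with the two known edge coefficients leaves only the one at
      \<open>j\<close>.\<close>
    have "load' {j1, q, j} i = 0"
      by (rule beside_hub) (use spokeD[OF that(1)] load_spoke[OF that(1)] in auto)
    then show ?thesis
      using spokeD[OF that(1)] spoke_gzq[OF that(1)] spoke_gz1[OF that(1)] that(2,3)
      by (simp add: load'_def)
  qed
  \<comment> \<open>Hub and spoke of \<open>q\<close> with \<open>T = {q}\<close> form a tight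
    point. It equates the hub coefficient with the y-coefficient of every \<open>q\<close> in
    \<open>J\<close>, which yields the common factor.\<close>
  have hub_gx: "gx $ k = gy $ q" if "hub k" and q: "q \<in> J" for k q
  proof -
    obtain s where s: "spoke q s" using spoke_exists[OF q] q by (auto simp: spoke_def)
    have "k \<in> I1" using that(1) by (simp add: hub_def)
    moreover have "real (card ({q} \<inter> J)) + load {q} k + load {q} s = 0"
      using spokeD[OF s] by (simp add: load_hub[OF that(1)] load_spoke[OF s])
    ultimately have "gy $ q + load' {q} k + load' {q} s = 0"
      using tight2[of k s "{q}"] spokeD(2)[OF s] by simp
    then show ?thesis
      using spokeD[OF s] spoke_gzq[OF s] hub_other[OF that(1), of q] by (simp add: load'_def)
  qed
  define c where "c = gx $ h"
  have gyJ: "gy $ q = c" if "q \<in> J" for q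
    using hub_gx[OF h that] by (simp add: c_def)
  \<comment> \<open>Any element of \<open>J\<close> carries the factor over from \<open>h\<close> to
    the other hubs.\<close>
  have hub_c: "gx $ k = c" if "hub k" for k
    using J hub_gx[OF that] gyJ by auto
  have "gy $ j = c * ay $ j" for j
    using gy0 gyJ by (simp add: ay)
  moreover have "gx $ i = c * ax $ i \<and> gz $ (i, j) = c * az $ (i, j)" for i j
  proof (cases rule: node_cases[of i])
    case 1
    then show ?thesis
      using hub_c[OF 1] hub_single[OF 1] hub_other[OF 1, of j] gyJ[of j] gy0[of j]
      by (cases "j = j1"; cases "j \<in> J") (use j1 in \<open>auto simp: hub_coeffs\<close>)
  next
    case (2 q)
    then have "q \<in> J" by (simp add: spoke_def)
    then show ?thesis
      using spokeD(4)[OF 2] spoke_gz1[OF 2] spoke_gzq[OF 2] spoke_gz[OF 2, of j] gyJ j1 2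
      by (cases "j = j1"; cases "j = q") (auto simp: spoke_coeffs)
  next
    case 3
    then show ?thesis using idle_gx[OF 3] idle_gz[OF 3] by (simp add: idle_coeffs)
  qed
  ultimately have "(gx, gy, gz) = c *\<^sub>R (ax, ay, az)"
    by (simp add: vec_eq_iff)
  then show ?thesis ..
qed

lemma facet: "defines_facet ((ax, ay, az), 0) (P_poly \<I>)"
proof -
  have vertex_in: "vertex S T \<in> P_poly \<I>" if "partial_transversal \<I> S" for S and T :: "'y set"
    unfolding P_poly_eq_vertices using that by (intro hull_inc) blast
  have valid: "(ax, ay, az) \<bullet> v \<ge> 0" if "v \<in> P_poly \<I>" for v
  proof -
    have "P_poly \<I> \<subseteq> {v. (ax, ay, az) \<bullet> v \<ge> 0}"
      unfolding P_poly_eq_vertices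
      by (rule hull_minimal) (use vertex_valid convex_halfspace_ge in auto)
    then show ?thesis using that by blast
  qed
  obtain q where q: "q \<in> J" using J by blast
  have "{v \<in> P_poly \<I>. (ax, ay, az) \<bullet> v = 0} facet_of P_poly \<I>"
  proof (rule facet_of_homogeneous_hyperplane)
    show "convex (P_poly \<I> :: ('x, 'y) xyz set)"
      by (simp add: P_poly_def)
    have "vertex {} {} = (0 :: ('x, 'y) xyz)"
      by (simp add: vertex_def zero_prod_def vec_eq_iff)
    then show "(0 :: ('x, 'y) xyz) \<in> P_poly \<I>"
      using vertex_in[OF partial_transversal_empty, of "{}"] by simp
    \<comment> \<open>Selecting only \<open>q\<close> from \<open>J\<close> gives the value 1, so
      the face is proper.\<close>
    show "vertex {} {q} \<in> P_poly \<I>" "(ax, ay, az) \<bullet> vertex {} {q} \<noteq> 0"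
      using q vertex_in[OF partial_transversal_empty] by (simp_all add: inner_vertex_load)
    show "\<exists>c. g = c *\<^sub>R (ax, ay, az)"
      if "\<And>v. v \<in> P_poly \<I> \<Longrightarrow> (ax, ay, az) \<bullet> v = 0 \<Longrightarrow> g \<bullet> v = 0" for g
      using form_unique[of "fst g" "fst (snd g)" "snd (snd g)"] that vertex_in by simp
  qed (use valid in auto)
  then show ?thesis using valid by simp
qed

end

section \<open>Coefficient tuples of the given inequality\<close>

text \<open>By injectivity at most one summand is 1. This turns sums over the index p into
  membership in the set \<open>J\<close> of the locale.\<close>

lemma sum_of_bool_inj_on:
  assumes "inj_on f A" "finite A"
  shows "(\<Sum>p\<in>A. of_bool (b = f p)) = (of_bool (b \<in> f ` A) :: real)"
proof -
  have "(\<Sum>p\<in>A. of_bool (b = f p)) = (\<Sum>c\<in>f ` A. of_bool (b = c) :: real)"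
    using assms(1) by (simp add: sum.reindex)
  also have "\<dots> = of_bool (b \<in> f ` A)"
    using assms(2) by (simp add: of_bool_def)
  finally show ?thesis .
qed

lemma axis_nth_of_bool: "axis k (1::real) $ l = of_bool (l = k)"
  by (simp add: axis_def)

lemma facet_coeffs_components:
  fixes i :: "nat \<Rightarrow> 'x::finite" and j :: "nat \<Rightarrow> 'y::finite"
  assumes "inj_on j {1..m}" "m \<ge> 1"
  obtains ax ay az where "facet_coeffs m i j = (ax, ay, az)"
    "\<And>k. ax $ k = of_bool (k = i 1)"
    "\<And>l. ay $ l = of_bool (l \<in> j ` {2..m})"
    "\<And>k l. az $ (k, l) = - of_bool (k = i 1) * (of_bool (l = j 1) + of_bool (l \<in> j ` {2..m}))
       + (\<Sum>p=2..m. of_bool (k = i p) * (of_bool (l = j 1) - of_bool (l = j p)))"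
proof -
  have inj: "inj_on j {2..m}" using assms by (rule_tac inj_on_subset) auto
  \<comment> \<open>The edges at \<open>i 1\<close> run over p from 1, the y-terms only from 2;
    splitting off p = 1 separates \<open>j 1\<close> from the rest.\<close>
  have ins: "{1..m} = insert 1 {2..m}" using assms(2) by auto
  let ?ay = "\<Sum>p=2..m. axis (j p) 1 :: real ^ 'y"
  let ?az = "- (\<Sum>p=1..m. axis (i 1, j p) 1) + (\<Sum>p=2..m. axis (i p, j 1) 1 - axis (i p, j p) 1)
    :: real ^ ('x \<times> 'y)"
  have y: "?ay $ l = of_bool (l \<in> j ` {2..m})" for l
    unfolding sum_component axis_nth_of_bool sum_of_bool_inj_on[OF inj finite_atLeastAtMost] ..
  have hub: "(\<Sum>p=1..m. of_bool ((k, l) = (i 1, j p)) :: real)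
      = of_bool (k = i 1) * (of_bool (l = j 1) + of_bool (l \<in> j ` {2..m}))" for k l
  proof -
    have "(\<Sum>p=1..m. of_bool (l = j p) :: real) = of_bool (l = j 1) + of_bool (l \<in> j ` {2..m})"
      unfolding ins sum_of_bool_inj_on[OF inj finite_atLeastAtMost, symmetric]
      by (rule sum.insert) auto
    then show ?thesis by (cases "k = i 1") (simp_all del: sum_of_bool_eq)
  qed
  have z: "?az $ (k, l) = - of_bool (k = i 1) * (of_bool (l = j 1) + of_bool (l \<in> j ` {2..m}))
       + (\<Sum>p=2..m. of_bool (k = i p) * (of_bool (l = j 1) - of_bool (l = j p)))" for k l
    unfolding vector_add_component vector_uminus_component vector_minus_component sum_component
      axis_nth_of_bool hub
    by (simp only: prod.inject of_bool_conj right_diff_distrib mult_minus_left)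
  show ?thesis by (rule that[OF facet_coeffs_def _ y z]) (rule axis_nth_of_bool)
qed

lemma node_tuple_facet_coeffs:
  fixes i :: "nat \<Rightarrow> 'x::finite" and j :: "nat \<Rightarrow> 'y::finite"
  assumes "inj_on j {1..m}" "m \<ge> 1" "inj_on i {2..m}" "i 1 \<notin> i ` {2..m}"
  shows "node_tuple (facet_coeffs m i j) (i 1) = hub_tuple (j 1) (j ` {2..m})"
    and "p \<in> {2..m} \<Longrightarrow> node_tuple (facet_coeffs m i j) (i p) = spoke_tuple (j 1) (j p)"
    and "k \<notin> i ` {1..m} \<Longrightarrow> node_tuple (facet_coeffs m i j) k = 0"
    and "y_coeffs (facet_coeffs m i j) = (\<chi> l. of_bool (l \<in> j ` {2..m}))"
proof -
  obtain ax ay az where a: "facet_coeffs m i j = (ax, ay, az)"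
    "\<And>k. ax $ k = of_bool (k = i 1)"
    "\<And>l. ay $ l = of_bool (l \<in> j ` {2..m})"
    "\<And>k l. az $ (k, l) = - of_bool (k = i 1) * (of_bool (l = j 1) + of_bool (l \<in> j ` {2..m}))
       + (\<Sum>p=2..m. of_bool (k = i p) * (of_bool (l = j 1) - of_bool (l = j p)))"
    using facet_coeffs_components[OF assms(1,2)] by blast
  have ins: "{1..m} = insert 1 {2..m}" using assms(2) by auto
  have "(\<Sum>p=2..m. of_bool (i 1 = i p) * (of_bool (l = j 1) - of_bool (l = j p))) = (0::real)" for l
    by (rule sum.neutral) (use assms(4) in auto)
  then show "node_tuple (facet_coeffs m i j) (i 1) = hub_tuple (j 1) (j ` {2..m})"
    by (simp add: a hub_tuple_def del: sum_of_bool_mult_eq sum_mult_of_bool_eq)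
  show "node_tuple (facet_coeffs m i j) (i p) = spoke_tuple (j 1) (j p)" if p: "p \<in> {2..m}"
  proof -
    \<comment> \<open>Injectivity of \<open>i\<close> on \<open>{2..m}\<close> leaves only the
      summand of \<open>p\<close> itself.\<close>
    have "(\<Sum>q=2..m. of_bool (i p = i q) * (of_bool (l = j 1) - of_bool (l = j q)))
        = (\<Sum>q=2..m. if q = p then of_bool (l = j 1) - of_bool (l = j q) else (0::real))" for l
      using inj_onD[OF assms(3)] p by (intro sum.cong) auto
    moreover have "i p \<noteq> i 1" using assms(4) p by (metis imageI)
    ultimately show ?thesis using p
      by (simp add: a spoke_tuple_def del: sum_of_bool_mult_eq sum_mult_of_bool_eq)
  qed
  show "node_tuple (facet_coeffs m i j) k = 0" if "k \<notin> i ` {1..m}"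
  proof -
    have "(\<Sum>p=2..m. of_bool (k = i p) * (of_bool (l = j 1) - of_bool (l = j p))) = (0::real)" for l
      by (rule sum.neutral) (use that in auto)
    moreover have "k \<noteq> i 1" using that ins by auto
    ultimately show ?thesis
      by (simp add: a zero_prod_def vec_eq_iff del: sum_of_bool_mult_eq sum_mult_of_bool_eq)
  qed
  show "y_coeffs (facet_coeffs m i j) = (\<chi> l. of_bool (l \<in> j ` {2..m}))"
    by (simp add: a vec_eq_iff)
qed

text \<open>Structure preservation guarantees only nonzero tuples to be chosen, so hub and spoke
  tuples have to be seen to be nonzero.\<close>

lemma hub_tuple_nonzero: "hub_tuple j1 J \<noteq> 0"
  by (simp add: hub_tuple_def zero_prod_def)

lemma spoke_tuple_nonzero: "q \<noteq> j1 \<Longrightarrow> spoke_tuple j1 q \<noteq> 0"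
  by (auto simp: spoke_tuple_def zero_prod_def vec_eq_iff intro!: exI[of _ j1])

section \<open>The inequality and its structure-preserving copyings\<close>

theorem theorem3p11:
  fixes \<I> :: "'x::finite set set"
    and I1 I2 :: "'x set"
    and m :: nat
    and i :: "nat \<Rightarrow> 'x"
    and j :: "nat \<Rightarrow> 'y::finite"
  assumes "partition_on UNIV \<I>"
    and "m \<ge> 3"
    and "I1 \<in> \<I>" and "I2 \<in> \<I>" and "I1 \<noteq> I2"
    and "i 1 \<in> I1"
    and "\<forall>p\<in>{2..m}. i p \<in> I2" and "inj_on i {2..m}"
    and "inj_on j {1..m}"
  shows "defines_facet (facet_coeffs m i j, 0) (P_poly \<I>) \<and>
    (\<forall>c. is_structure_preserving_copying \<I> (facet_coeffs m i j, 0) c \<longrightarrow>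
       defines_facet c (P_poly \<I>))"
proof -
  let ?a = "facet_coeffs m i j" and ?J = "j ` {2..m}"
  have disj: "I1 \<inter> I2 = {}"
    using assms(1,3-5) by (metis partition_onD2 disjointD)
  have other: "k \<notin> I" if "k \<in> I'" "I \<in> \<I>" "I' \<in> \<I>" "I \<noteq> I'" for k I I'
    using assms(1) that by (metis partition_onD2 disjointD disjoint_iff)
  have i1: "i 1 \<notin> i ` {2..m}" using assms(6,7) disj by (metis disjoint_iff imageE)
  have ins: "{1..m} = insert 1 {2..m}" using assms(2) by auto
  have ins_image: "i ` {1..m} = insert (i 1) (i ` {2..m})" unfolding ins by simp
  have j1: "j 1 \<notin> ?J" using assms(9) unfolding ins by auto
  have "m \<ge> 1" using assms(2) by simp
  note tuples = node_tuple_facet_coeffs[OF assms(9) this assms(8) i1]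
  have copy: "defines_facet c (P_poly \<I>)"
    if c: "is_structure_preserving_copying \<I> (?a, 0) c" for c
  proof -
    obtain bx bY bz \<gamma> where c_eq: "c = ((bx, bY, bz), \<gamma>)" by (metis prod.collapse)
    let ?b = "(bx, bY, bz)"
    have \<gamma>: "\<gamma> = 0" and y: "bY = y_coeffs ?a"
      and in_set: "\<And>I k. I \<in> \<I> \<Longrightarrow> k \<in> I \<Longrightarrow> node_tuple ?b k \<in> node_tuple ?a ` I"
      and attained: "\<And>I k. I \<in> \<I> \<Longrightarrow> k \<in> I \<Longrightarrow> node_tuple ?a k \<noteq> 0 \<Longrightarrow>
        \<exists>l\<in>I. node_tuple ?b l = node_tuple ?a k"
      using c by (auto simp: c_eq tuple_set_def zero_prod_def simp del: node_tuple.simps)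
    have set1: "node_tuple ?a ` I1 \<subseteq> {hub_tuple (j 1) ?J, 0}"
    proof (rule image_subsetI)
      fix k assume "k \<in> I1"
      then have "k \<notin> i ` {2..m}" using assms(7) disj by (metis disjoint_iff imageE)
      then have "k = i 1 \<or> k \<notin> i ` {1..m}" unfolding ins_image by blast
      then show "node_tuple ?a k \<in> {hub_tuple (j 1) ?J, 0}" using tuples(1,3) by auto
    qed
    have set2: "node_tuple ?a ` I2 \<subseteq> insert 0 (spoke_tuple (j 1) ` ?J)"
    proof (rule image_subsetI)
      fix k assume "k \<in> I2"
      then have "k \<noteq> i 1" using assms(6) disj by blast
      then have "k \<in> i ` {2..m} \<or> k \<notin> i ` {1..m}" unfolding ins_image by blast
      then show "node_tuple ?a k \<in> insert 0 (spoke_tuple (j 1) ` ?J)" using tuples(2,3) by auto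
    qed
    \<comment> \<open>All of \<open>i 1\<close>, ..., \<open>i m\<close> lie in \<open>I1\<close> or
      \<open>I2\<close>, so any other class offers only the zero tuple for copying.\<close>
    have set0: "node_tuple ?a ` I \<subseteq> {0}" if I: "I \<in> \<I>" "I \<noteq> I1" "I \<noteq> I2" for I
    proof (rule image_subsetI)
      fix k assume k: "k \<in> I"
      have "k \<notin> I1" "k \<notin> I2" using other[OF k _ I(1)] I assms(3,4) by auto
      then have "k \<notin> i ` {1..m}" using assms(6,7) by (metis ins_image imageE insertE)
      then show "node_tuple ?a k \<in> {0}" using tuples(3) by auto
    qed
    interpret copied_inequality \<I> I1 I2 bx bY bz "j 1" ?J
    proof
      show "bY = (\<chi> l. of_bool (l \<in> ?J))" by (simp only: y tuples(4))
      show "?J \<noteq> {}" using assms(2) by simp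
      show "node_tuple ?b k \<in> {hub_tuple (j 1) ?J, 0}" if "k \<in> I1" for k
        using in_set[OF assms(3) that] set1 by blast
      show "node_tuple ?b k \<in> insert 0 (spoke_tuple (j 1) ` ?J)" if "k \<in> I2" for k
        using in_set[OF assms(4) that] set2 by blast
      show "node_tuple ?b k = 0" if "k \<notin> I1" "k \<notin> I2" for k
      proof -
        obtain I where "I \<in> \<I>" "k \<in> I" using partition_onD1[OF assms(1)] by blast
        then show ?thesis using in_set[of I k] set0[of I] that by blast
      qed
      show "\<exists>k\<in>I1. node_tuple ?b k = hub_tuple (j 1) ?J"
        using attained[OF assms(3,6)] by (simp only: tuples(1) hub_tuple_nonzero) blast
      show "\<exists>k\<in>I2. node_tuple ?b k = spoke_tuple (j 1) q" if q: "q \<in> ?J" for q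
      proof -
        obtain p where p: "p \<in> {2..m}" "q = j p" using q by blast
        then have "j p \<noteq> j 1" using q j1 by metis
        moreover have "i p \<in> I2" using assms(7) p by blast
        ultimately show ?thesis
          using attained[OF assms(4), of "i p"] tuples(2)[OF p(1)] p(2)
            spoke_tuple_nonzero[of "j p" "j 1"] by metis
      qed
    qed (use assms j1 in auto)
    show ?thesis using facet by (simp only: c_eq \<gamma>)
  qed
  \<comment> \<open>The inequality is a structure-preserving copying of itself, so the first claim
    is an instance of the second.\<close>
  moreover have "is_structure_preserving_copying \<I> (?a, 0) (?a, 0)"
    by (auto simp: tuple_set_def)
  ultimately show ?thesis by blast
qed

end
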